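(* Every multiple unicast instance $\langle G,\{s_i-t_i\}_1^3\rangle$ with three unit-entropy sessions whose connectivity level $[k_1~k_2~k_3]$ is greater than $[1~3~3]$ is feasible.
   Context: A network is a finite directed acyclic graph $G=(V,E)$ (parallel edges allowed) in which every edge has unit capacity. A multiple unicast instance $\langle G,\{s_i-t_i\}_1^n\rangle$ consists of $G$ together with source nodes $s_i$ (having no incoming edges) and terminal nodes $t_i$ (having no outgoing edges). Each source $s_i$ observes a unit-entropy message to be communicated to $t_i$; messages are independent. The connectivity level is the vector $[k_1~\dots~k_n]$ where $k_i$ is the maximum flow from $s_i$ to $t_i$ in $G$. Connectivity levels are compared componentwise: $[k_1~k_2~k_3]$ is greater than $[1~3~3]$ if $k_1\ge 1$, $k_2\ge 3$, $k_3\ge 3$ and the two vectors are not equal. Linear network codes: for a finite field $\mathbb{F}_q$ (with $q$ free to be chosen) and vector length $T\ge 1$, each unit-entropy message is a vector in $\mathbb{F}_q^T$; each edge carries a vector in $\mathbb{F}_q^T$ that is an $\mathbb{F}_q$-linear function of the vectors carried on the incoming edges of its tail and of the messages observed at its tail. The code is a solution if every terminal $t_i$ can recover the message of $s_i$ (for all message values) from the vectors on its incoming edges. The case $T=1$ is called scalar, general $T$ is called vector linear network coding. The instance is feasible if it has a (scalar or vector) linear network coding solution for some $q$ and $T$. *)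

theory Defs
  imports Complex_Main "HOL-Library.FuncSet" "HOL-Algebra.Module" "Graph_Theory.Digraph"
begin

section \<open>Flows in unit capacity networks\<close>

definition is_flow :: "('a, 'b) pre_digraph \<Rightarrow> 'a \<Rightarrow> 'a \<Rightarrow> ('b \<Rightarrow> real) \<Rightarrow> bool" where
  "is_flow G u v f \<longleftrightarrow>
     (\<forall>e\<in>arcs G. 0 \<le> f e \<and> f e \<le> 1) \<and>
     (\<forall>w\<in>verts G - {u, v}. (\<Sum>e\<in>in_arcs G w. f e) = (\<Sum>e\<in>out_arcs G w. f e))"

definition flow_value :: "('a, 'b) pre_digraph \<Rightarrow> 'a \<Rightarrow> ('b \<Rightarrow> real) \<Rightarrow> real" where
  "flow_value G u f = (\<Sum>e\<in>out_arcs G u. f e) - (\<Sum>e\<in>in_arcs G u. f e)"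

definition max_flow :: "('a, 'b) pre_digraph \<Rightarrow> 'a \<Rightarrow> 'a \<Rightarrow> real" where
  "max_flow G u v = Sup {flow_value G u f | f. is_flow G u v f}"


section \<open>Multiple unicast instances\<close>

text \<open>Parallel arcs are allowed in \<^locale>\<open>fin_digraph\<close>.  The nodes \<^term>\<open>s i\<close> (and likewise
  \<^term>\<open>t i\<close>) are not required to be distinct, so a node may observe several messages.\<close>

locale multiple_unicast = fin_digraph G
  for G :: "('a, 'b) pre_digraph" (structure) and n :: nat and s t :: "nat \<Rightarrow> 'a" +
  assumes acyclic_arcs: "acyclic (arcs_ends G)"
    and source_in_verts: "i \<in> {1..n} \<Longrightarrow> s i \<in> verts G"
    and terminal_in_verts: "i \<in> {1..n} \<Longrightarrow> t i \<in> verts G"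
    and no_arc_into_source: "i \<in> {1..n} \<Longrightarrow> in_arcs G (s i) = {}"
    and no_arc_from_terminal: "i \<in> {1..n} \<Longrightarrow> out_arcs G (t i) = {}"


section \<open>Powers of a module and linear maps\<close>

definition self_module :: "'c ring \<Rightarrow> ('c, 'c) module" where
  "self_module F =
     \<lparr>carrier = carrier F, mult = mult F, one = one F, zero = zero F, add = add F,
      smult = mult F\<rparr>"

text \<open>The multiplicative components of the record play no role for modules.\<close>

definition power_module :: "'i set \<Rightarrow> ('c, 'd) module \<Rightarrow> ('c, 'i \<Rightarrow> 'd) module" where
  "power_module I M =
     \<lparr>carrier = I \<rightarrow>\<^sub>E carrier M,
      mult = (\<lambda>x y. \<lambda>i\<in>I. x i \<otimes>\<^bsub>M\<^esub> y i),
      one = (\<lambda>i\<in>I. \<one>\<^bsub>M\<^esub>),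
      zero = (\<lambda>i\<in>I. \<zero>\<^bsub>M\<^esub>),
      add = (\<lambda>x y. \<lambda>i\<in>I. x i \<oplus>\<^bsub>M\<^esub> y i),
      smult = (\<lambda>a x. \<lambda>i\<in>I. a \<odot>\<^bsub>M\<^esub> x i)\<rparr>"

definition vec_space :: "'c ring \<Rightarrow> nat \<Rightarrow> ('c, nat \<Rightarrow> 'c) module" where
  "vec_space F T = power_module {..<T} (self_module F)"

definition linear_map ::
  "'c ring \<Rightarrow> ('c, 'd) module \<Rightarrow> ('c, 'e) module \<Rightarrow> ('d \<Rightarrow> 'e) \<Rightarrow> bool" where
  "linear_map F M N \<phi> \<longleftrightarrow>
     \<phi> \<in> carrier M \<rightarrow> carrier N \<and>
     (\<forall>x\<in>carrier M. \<forall>y\<in>carrier M. \<phi> (x \<oplus>\<^bsub>M\<^esub> y) = \<phi> x \<oplus>\<^bsub>N\<^esub> \<phi> y) \<and>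
     (\<forall>a\<in>carrier F. \<forall>x\<in>carrier M. \<phi> (a \<odot>\<^bsub>M\<^esub> x) = a \<odot>\<^bsub>N\<^esub> \<phi> x)"

lemma module_self_module:
  assumes "cring F"
  shows "Module.module F (self_module F)"
proof -
  interpret cring F by fact
  show ?thesis
    by (rule moduleI[OF assms])
       (auto simp: self_module_def l_distr r_distr m_assoc a_assoc a_comm a_lcomm
             intro!: abelian_groupI)
qed

lemma module_power_module:
  assumes "Module.module F M"
  shows "Module.module F (power_module I M)"
proof -
  interpret Module.module F M by fact
  let ?P = "power_module I M"
  have inverse: "\<exists>y\<in>carrier ?P. y \<oplus>\<^bsub>?P\<^esub> x = \<zero>\<^bsub>?P\<^esub>" if "x \<in> carrier ?P" for x
    using that
    by (intro bexI[of _ "\<lambda>i\<in>I. \<ominus>\<^bsub>M\<^esub> x i"])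
       (auto simp: power_module_def intro!: restrict_ext M.l_neg)
  have "abelian_group ?P"
    by (rule abelian_groupI[OF _ _ _ _ _ inverse])
       (auto simp: power_module_def PiE_iff extensional_def fun_eq_iff M.a_assoc M.a_comm M.a_lcomm)
  then show ?thesis
    by (intro moduleI)
       (auto simp: power_module_def PiE_iff extensional_def fun_eq_iff
          smult_l_distr smult_r_distr smult_assoc1 R.is_cring)
qed

lemma module_vec_space: "cring F \<Longrightarrow> Module.module F (vec_space F T)"
  unfolding vec_space_def by (intro module_power_module module_self_module)


section \<open>Linear network codes\<close>

definition inputs :: "('a, 'b) pre_digraph \<Rightarrow> nat \<Rightarrow> (nat \<Rightarrow> 'a) \<Rightarrow> 'a \<Rightarrow> ('b + nat) set" where
  "inputs G n s v = Inl ` in_arcs G v \<union> Inr ` {i \<in> {1..n}. s i = v}"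

definition messages :: "nat \<Rightarrow> 'c ring \<Rightarrow> nat \<Rightarrow> (nat \<Rightarrow> nat \<Rightarrow> 'c) set" where
  "messages n F T = {1..n} \<rightarrow>\<^sub>E carrier (vec_space F T)"

text \<open>\<^term>\<open>Y x e\<close> is the vector on arc \<^term>\<open>e\<close> when the messages are \<^term>\<open>x\<close>.\<close>

definition linear_network_code ::
  "('a, 'b) pre_digraph \<Rightarrow> nat \<Rightarrow> (nat \<Rightarrow> 'a) \<Rightarrow> 'c ring \<Rightarrow> nat \<Rightarrow>
   ((nat \<Rightarrow> nat \<Rightarrow> 'c) \<Rightarrow> 'b \<Rightarrow> nat \<Rightarrow> 'c) \<Rightarrow> bool" where
  "linear_network_code G n s F T Y \<longleftrightarrow>
     (\<forall>e\<in>arcs G. \<exists>\<phi>.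
        linear_map F (power_module (inputs G n s (tail G e)) (vec_space F T)) (vec_space F T) \<phi> \<and>
        (\<forall>x\<in>messages n F T.
           Y x e = \<phi> (restrict (case_sum (Y x) x) (inputs G n s (tail G e)))))"

definition recoverable ::
  "('a, 'b) pre_digraph \<Rightarrow> nat \<Rightarrow> (nat \<Rightarrow> 'a) \<Rightarrow> 'c ring \<Rightarrow> nat \<Rightarrow>
   ((nat \<Rightarrow> nat \<Rightarrow> 'c) \<Rightarrow> 'b \<Rightarrow> nat \<Rightarrow> 'c) \<Rightarrow> nat \<Rightarrow> bool" where
  "recoverable G n t F T Y i \<longleftrightarrow>
     (\<exists>D. \<forall>x\<in>messages n F T. D (restrict (Y x) (in_arcs G (t i))) = x i)"

text \<open>Every finite field is isomorphic to one whose elements are integers, so taking the carrier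
  of \<^term>\<open>F\<close> inside \<^typ>\<open>int\<close> is no restriction on the field.\<close>

definition feasible ::
  "('a, 'b) pre_digraph \<Rightarrow> nat \<Rightarrow> (nat \<Rightarrow> 'a) \<Rightarrow> (nat \<Rightarrow> 'a) \<Rightarrow> bool" where
  "feasible G n s t \<longleftrightarrow>
     (\<exists>(F :: int ring) T Y. field F \<and> finite (carrier F) \<and> T \<ge> 1 \<and>
        linear_network_code G n s F T Y \<and> (\<forall>i\<in>{1..n}. recoverable G n t F T Y i))"

end

(* Idea: two time slots over the field with two elements. Slot 0 serves sessions 1 and 2, slot 1
   serves sessions 1 and 3; each slot carries one symbol X of the first message and both symbols
   of the other message, so it suffices to achieve the rate pair (1,2) for connectivity (1,3).

   Let P be an s1-t1 path and Q_0, Q_1, Q_2 arc-disjoint s2-t2 paths. Give each Q_j a label u_j,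
   where the path Q_j0 that P meets last has u_j0 = 0 and the other two labels are the two symbols.
   After P has met some Q_k most recently it carries X + u_k (and X before any meeting). Before its
   first arc shared with P, Q_j carries u_j minus the label that P brings to that arc; on this arc
   the two inputs add up to X + u_j, which Q_j carries from then on. Then P delivers
   X + u_j0 = X to t1, and Q_j0 delivers the same X to t2, which can thus read off all labels. *)
theory Submission
  imports Defs "Graph_Theory.Arc_Walk" "HOL-Number_Theory.Residues"
begin

section \<open>Disjoint walks from maximum flows\<close>

context fin_digraph
begin

section \<open>Weak duality between flows and cuts\<close>

lemma sum_flow_value:
  assumes "finite U"
  shows "(\<Sum>w\<in>U. flow_value G w f) =
    sum f {e\<in>arcs G. tail G e \<in> U \<and> head G e \<notin> U} - sum f {e\<in>arcs G. tail G e \<notin> U \<and> head G e \<in> U}"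
proof -
  let ?B = "{e\<in>arcs G. tail G e \<in> U \<and> head G e \<in> U}"
  have "(\<Sum>w\<in>U. sum f (out_arcs G w)) = sum f (\<Union>w\<in>U. out_arcs G w)"
    by (rule sum.UNION_disjoint[symmetric]) (use assms in auto)
  also have "(\<Union>w\<in>U. out_arcs G w) = ?B \<union> {e\<in>arcs G. tail G e \<in> U \<and> head G e \<notin> U}"
    by auto
  also have "sum f \<dots> = sum f ?B + sum f {e\<in>arcs G. tail G e \<in> U \<and> head G e \<notin> U}"
    by (rule sum.union_disjoint) auto
  finally have out: "(\<Sum>w\<in>U. sum f (out_arcs G w)) = \<dots>" .
  have "(\<Sum>w\<in>U. sum f (in_arcs G w)) = sum f (\<Union>w\<in>U. in_arcs G w)"
    by (rule sum.UNION_disjoint[symmetric]) (use assms in auto)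
  also have "(\<Union>w\<in>U. in_arcs G w) = ?B \<union> {e\<in>arcs G. tail G e \<notin> U \<and> head G e \<in> U}"
    by auto
  also have "sum f \<dots> = sum f ?B + sum f {e\<in>arcs G. tail G e \<notin> U \<and> head G e \<in> U}"
    by (rule sum.union_disjoint) auto
  finally have inn: "(\<Sum>w\<in>U. sum f (in_arcs G w)) = \<dots>" .
  show ?thesis
    using out inn by (simp add: flow_value_def sum_subtractf)
qed

text \<open>When the net outflows are added up over \<open>U\<close>, only \<open>u\<close>
  contributes, and arcs with both ends in \<open>U\<close> cancel.\<close>

lemma flow_value_eq_cut:
  assumes "U \<subseteq> verts G" "u \<in> U" "\<And>w. w \<in> U \<Longrightarrow> w \<noteq> u \<Longrightarrow> flow_value G w f = 0"
  shows "flow_value G u f =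
    sum f {e\<in>arcs G. tail G e \<in> U \<and> head G e \<notin> U} - sum f {e\<in>arcs G. tail G e \<notin> U \<and> head G e \<in> U}"
proof -
  have fin: "finite U" using finite_subset[OF assms(1)] by simp
  have "(\<Sum>w\<in>U. flow_value G w f) = flow_value G u f"
    using sum.remove[OF fin assms(2), of "\<lambda>w. flow_value G w f"] assms(3) by simp
  then show ?thesis using sum_flow_value[OF fin, of f] by simp
qed

text \<open>The net flow across a cut is at most what its outgoing arcs can hold, one unit each.
  This turns a lower bound on the supremum \<open>max_flow\<close> into lower bounds on cut sizes,
  the only form in which it is used for constructing walks.\<close>

lemma max_flow_le_cut:
  assumes U: "U \<subseteq> verts G" "u \<in> U" "v \<notin> U"
  shows "max_flow G u v \<le> real (card {e\<in>arcs G. tail G e \<in> U \<and> head G e \<notin> U})" (is "_ \<le> real (card ?C)")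
  unfolding max_flow_def
proof (rule cSup_least)
  have "is_flow G u v (\<lambda>_. 0)" by (simp add: is_flow_def)
  then show "{flow_value G u f |f. is_flow G u v f} \<noteq> {}" by blast
next
  fix x assume "x \<in> {flow_value G u f |f. is_flow G u v f}"
  then obtain f where x: "x = flow_value G u f" and f: "is_flow G u v f" by blast
  have "flow_value G w f = 0" if "w \<in> U" "w \<noteq> u" for w
  proof -
    have "w \<in> verts G - {u, v}" using U that by blast
    then show ?thesis using f by (simp add: is_flow_def flow_value_def)
  qed
  then have "x = sum f ?C - sum f {e\<in>arcs G. tail G e \<notin> U \<and> head G e \<in> U}"
    unfolding x using U by (intro flow_value_eq_cut)
  moreover have "sum f {e\<in>arcs G. tail G e \<notin> U \<and> head G e \<in> U} \<ge> 0"
    using f by (intro sum_nonneg) (auto simp: is_flow_def)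
  moreover have "sum f ?C \<le> (\<Sum>e\<in>?C. 1)"
    using f by (intro sum_mono) (auto simp: is_flow_def)
  ultimately show "x \<le> real (card ?C)" by simp
qed

text \<open>An arc set \<open>A\<close> stands for the 0/1 flow that is 1 exactly on
  \<open>A\<close>. Integral flows thus become sets of arcs, and augmentation becomes insertion and
  removal.\<close>

definition excess :: "'b set \<Rightarrow> 'a \<Rightarrow> real" where
  "excess A w = flow_value G w (\<lambda>e. of_bool (e \<in> A))"

lemma excess_card: "excess A w = real (card (out_arcs G w \<inter> A)) - real (card (in_arcs G w \<inter> A))"
  by (simp add: excess_def flow_value_def finite_in_arcs finite_out_arcs)

lemma excess_insert:
  assumes "e \<in> arcs G" "e \<notin> A"
  shows "excess (insert e A) w = excess A w + of_bool (w = tail G e) - of_bool (w = head G e)"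
  using assms by (auto simp: excess_card finite_in_arcs finite_out_arcs)

lemma excess_remove:
  assumes "e \<in> arcs G" "e \<in> A"
  shows "excess (A - {e}) w = excess A w - of_bool (w = tail G e) + of_bool (w = head G e)"
  using excess_insert[OF assms(1), of "A - {e}" w] assms(2) by (simp add: insert_absorb)

section \<open>Augmentation and integral flows\<close>

definition residual :: "'b set \<Rightarrow> ('a \<times> 'a) set" where
  "residual A = {(tail G e, head G e) |e. e \<in> arcs G - A} \<union> {(head G e, tail G e) |e. e \<in> A}"

text \<open>Augmentation proceeds along shortest residual paths; the last clause says that an arc leading
  to a new layer has not yet been changed.\<close>

lemma augment_layer:
  assumes A: "A \<subseteq> arcs G" and path: "(u, w) \<in> residual A ^^ n"
    and shortest: "\<And>m. m < n \<Longrightarrow> (u, w) \<notin> residual A ^^ m"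
  shows "\<exists>B\<subseteq>arcs G. (\<forall>x. excess B x = excess A x + of_bool (x = u) - of_bool (x = w)) \<and>
    (\<forall>e. (e \<in> A) \<noteq> (e \<in> B) \<longrightarrow>
      (\<exists>m\<le>n. (u, tail G e) \<in> residual A ^^ m) \<and> (\<exists>m\<le>n. (u, head G e) \<in> residual A ^^ m))"
  using path shortest
proof (induction n arbitrary: w)
  case 0
  then show ?case using A by (intro exI[of _ A]) auto
next
  case (Suc n)
  from Suc.prems(1) obtain x where x: "(u, x) \<in> residual A ^^ n" "(x, w) \<in> residual A" by auto
  have "(u, x) \<notin> residual A ^^ m" if "m < n" for m
  proof
    assume "(u, x) \<in> residual A ^^ m"
    then have "(u, w) \<in> residual A ^^ Suc m" using x(2) by auto
    then show False using Suc.prems(2)[of "Suc m"] that by simp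
  qed
  from Suc.IH[OF x(1) this] obtain B where B: "B \<subseteq> arcs G"
    "\<And>y. excess B y = excess A y + of_bool (y = u) - of_bool (y = x)"
    "\<And>e. (e \<in> A) \<noteq> (e \<in> B) \<Longrightarrow>
      (\<exists>m\<le>n. (u, tail G e) \<in> residual A ^^ m) \<and> (\<exists>m\<le>n. (u, head G e) \<in> residual A ^^ m)"
    by blast
  define near where "near y \<longleftrightarrow> (\<exists>m\<le>Suc n. (u, y) \<in> residual A ^^ m)" for y
  \<comment> \<open>A previously changed arc at \<open>w\<close> would put \<open>w\<close> within
    \<open>n\<close> steps of \<open>u\<close>. So the arc of the last residual step still has the
    same status in \<open>B\<close> as in \<open>A\<close>, and changing it now has the intended
    effect.\<close>
  have new: "\<not> (\<exists>m\<le>n. (u, w) \<in> residual A ^^ m)"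
    using Suc.prems(2) by auto
  have near: "near x" "near w"
    using x(1) Suc.prems(1) le_SucI unfolding near_def by blast+
  have old: "near (tail G e) \<and> near (head G e)" if "(e \<in> A) \<noteq> (e \<in> B)" for e
    using B(3)[OF that] le_SucI unfolding near_def by blast
  from x(2) consider e where "e \<in> arcs G - A" "tail G e = x" "head G e = w"
    | e where "e \<in> A" "tail G e = w" "head G e = x"
    unfolding residual_def by blast
  then have "\<exists>C\<subseteq>arcs G. (\<forall>y. excess C y = excess A y + of_bool (y = u) - of_bool (y = w)) \<and>
    (\<forall>e. (e \<in> A) \<noteq> (e \<in> C) \<longrightarrow> near (tail G e) \<and> near (head G e))"
  proof cases
    case 1
    then have "e \<notin> B" using B(3)[of e] new by auto
    then have "excess (insert e B) y = excess A y + of_bool (y = u) - of_bool (y = w)" for y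
      using 1 by (simp add: excess_insert B(2))
    moreover have "near (tail G f) \<and> near (head G f)" if "(f \<in> A) \<noteq> (f \<in> insert e B)" for f
      using that old[of f] near 1 by (cases "f = e") auto
    ultimately show ?thesis using 1 B(1) by (intro exI[of _ "insert e B"]) auto
  next
    case 2
    then have "e \<in> B" using B(3)[of e] new by auto
    then have "excess (B - {e}) y = excess A y + of_bool (y = u) - of_bool (y = w)" for y
      using 2 A by (subst excess_remove) (auto simp: B(2))
    moreover have "near (tail G f) \<and> near (head G f)" if "(f \<in> A) \<noteq> (f \<in> B - {e})" for f
      using that old[of f] near 2 by (cases "f = e") auto
    ultimately show ?thesis using B(1) by (intro exI[of _ "B - {e}"]) auto
  qed
  then show ?case unfolding near_def .
qed

text \<open>Ford-Fulkerson by induction on \<open>k\<close>: a flow of value \<open>k\<close> can be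
  augmented as long as every cut has more than \<open>k\<close> outgoing arcs.\<close>

lemma integral_flow:
  assumes u: "u \<in> verts G"
    and cut: "\<And>U. U \<subseteq> verts G \<Longrightarrow> u \<in> U \<Longrightarrow> v \<notin> U \<Longrightarrow>
      k \<le> card {e\<in>arcs G. tail G e \<in> U \<and> head G e \<notin> U}"
  shows "\<exists>A\<subseteq>arcs G. \<forall>x. excess A x = real k * (of_bool (x = u) - of_bool (x = v))"
  using cut
proof (induction k)
  case 0
  show ?case by (intro exI[of _ "{}"]) (simp add: excess_def flow_value_def)
next
  case (Suc k)
  then obtain A where A: "A \<subseteq> arcs G" "\<And>x. excess A x = real k * (of_bool (x = u) - of_bool (x = v))"
    using Suc_leD by meson
  define U where "U = (residual A)\<^sup>* `` {u}"
  have step: "y \<in> U" if "x \<in> U" "(x, y) \<in> residual A" for x y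
    using that unfolding U_def by (auto intro: rtrancl_into_rtrancl)
  have "residual A \<subseteq> verts G \<times> verts G"
    using A(1) by (auto simp: residual_def)
  then have sub: "U \<subseteq> verts G"
    unfolding U_def using u by (auto elim: rtranclE)
  have uU: "u \<in> U" by (simp add: U_def)
  \<comment> \<open>Otherwise all arcs leaving the residually reachable set \<open>U\<close> lie in
    \<open>A\<close> and none entering it does. The value of \<open>A\<close> would then be the size
    of the cut, at least \<open>Suc k\<close>, whereas it is \<open>k\<close>.\<close>
  have "v \<in> U"
  proof (rule ccontr)
    assume v: "v \<notin> U"
    have "excess A u = (\<Sum>e | e \<in> arcs G \<and> tail G e \<in> U \<and> head G e \<notin> U. of_bool (e \<in> A))
        - (\<Sum>e | e \<in> arcs G \<and> tail G e \<notin> U \<and> head G e \<in> U. of_bool (e \<in> A))"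
      unfolding excess_def using A(2) v
      by (intro flow_value_eq_cut sub uU) (auto simp: excess_def)
    also have "(\<Sum>e | e \<in> arcs G \<and> tail G e \<in> U \<and> head G e \<notin> U. of_bool (e \<in> A) :: real)
        = (\<Sum>e | e \<in> arcs G \<and> tail G e \<in> U \<and> head G e \<notin> U. 1)"
      by (rule sum.cong) (use step in \<open>auto simp: residual_def\<close>)
    also have "(\<Sum>e | e \<in> arcs G \<and> tail G e \<notin> U \<and> head G e \<in> U. of_bool (e \<in> A) :: real) = 0"
      by (rule sum.neutral) (use step in \<open>auto simp: residual_def\<close>)
    finally have "excess A u = real (card {e\<in>arcs G. tail G e \<in> U \<and> head G e \<notin> U})" by simp
    moreover have "Suc k \<le> card {e\<in>arcs G. tail G e \<in> U \<and> head G e \<notin> U}"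
      by (rule Suc.prems[OF sub uU v])
    ultimately show False using A(2)[of u] uU v by (cases "u = v") auto
  qed
  then have "\<exists>n. (u, v) \<in> residual A ^^ n"
    unfolding U_def by (simp add: rtrancl_power)
  then obtain n where "(u, v) \<in> residual A ^^ n" "\<And>m. m < n \<Longrightarrow> (u, v) \<notin> residual A ^^ m"
    using exists_least_iff[of "\<lambda>n. (u, v) \<in> residual A ^^ n"] by blast
  from augment_layer[OF A(1) this] obtain B where "B \<subseteq> arcs G"
    "\<And>x. excess B x = excess A x + of_bool (x = u) - of_bool (x = v)"
    by blast
  then show ?case using A(2)
    by (intro exI[of _ B]) (auto simp: algebra_simps)
qed

section \<open>Extracting walks from an integral flow\<close>

lemma excess_remove_awalk:
  assumes "awalk u p v" "distinct p" "set p \<subseteq> A"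
  shows "excess (A - set p) x = excess A x - of_bool (x = u) + of_bool (x = v)"
  using assms
proof (induction p arbitrary: u A)
  case Nil
  then show ?case by (auto simp: awalk_def)
next
  case (Cons e p)
  have w: "awalk (head G e) p v" "e \<in> arcs G" "tail G e = u"
    using Cons.prems(1) by (auto simp: awalk_Cons_iff)
  have "excess (A - {e} - set p) x = excess (A - {e}) x - of_bool (x = head G e) + of_bool (x = v)"
    by (rule Cons.IH) (use Cons.prems w in auto)
  moreover have "A - {e} - set p = A - set (e # p)" by auto
  ultimately show ?case
    using excess_remove[OF w(2), of A x] Cons.prems(3) w(3) by simp
qed

text \<open>No arc of \<open>A\<close> leaves the set of nodes reachable along \<open>A\<close>. If
  \<open>v\<close> were outside this set, the net outflow at \<open>u\<close> could not be
  positive.\<close>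

lemma awalk_in_flow:
  assumes A: "A \<subseteq> arcs G" and u: "u \<in> verts G"
    and flow: "\<And>x. x \<noteq> u \<Longrightarrow> x \<noteq> v \<Longrightarrow> excess A x = 0" and pos: "excess A u > 0"
  shows "\<exists>p. awalk u p v \<and> set p \<subseteq> A"
proof -
  define U where "U = {w. \<exists>p. awalk u p w \<and> set p \<subseteq> A}"
  have step: "head G e \<in> U" if "e \<in> A" "tail G e \<in> U" for e
  proof -
    from that obtain p where p: "awalk u p (tail G e)" "set p \<subseteq> A" by (auto simp: U_def)
    have "awalk u (p @ [e]) (head G e)"
      using p(1) that(1) A by (intro awalk_appendI) (auto simp: awalk_Cons_iff awalk_Nil_iff)
    then show ?thesis using p(2) that(1) unfolding U_def by (intro CollectI exI[of _ "p @ [e]"]) auto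
  qed
  have "v \<in> U"
  proof (rule ccontr)
    assume v: "v \<notin> U"
    have uU: "u \<in> U" using u by (auto simp: U_def awalk_Nil_iff intro!: exI[of _ "[]"])
    have "excess A u = (\<Sum>e | e \<in> arcs G \<and> tail G e \<in> U \<and> head G e \<notin> U. of_bool (e \<in> A))
        - (\<Sum>e | e \<in> arcs G \<and> tail G e \<notin> U \<and> head G e \<in> U. of_bool (e \<in> A))"
      unfolding excess_def
      by (intro flow_value_eq_cut uU) (use flow v in \<open>auto simp: excess_def U_def\<close>)
    also have "(\<Sum>e | e \<in> arcs G \<and> tail G e \<in> U \<and> head G e \<notin> U. of_bool (e \<in> A) :: real) = 0"
      by (rule sum.neutral) (use step in auto)
    also have "0 - (\<Sum>e | e \<in> arcs G \<and> tail G e \<notin> U \<and> head G e \<in> U. of_bool (e \<in> A) :: real) \<le> 0"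
      by (simp add: sum_nonneg)
    finally show False using pos by simp
  qed
  then show ?thesis by (simp add: U_def)
qed

end

section \<open>Arc-disjoint walks in acyclic networks\<close>

locale acyclic_digraph = fin_digraph +
  assumes acyclic_arcs: "acyclic (arcs_ends G)"
begin

text \<open>A topological rank. Since it belongs to nodes and not to a walk, it shows that two walks
  traverse their common arcs in the same order.\<close>

definition depth :: "'a \<Rightarrow> nat" where
  "depth v = card {w. w \<rightarrow>\<^sup>+ v}"

lemma depth_less:
  assumes "e \<in> arcs G"
  shows "depth (tail G e) < depth (head G e)"
proof -
  have e: "tail G e \<rightarrow> head G e" using assms by (auto simp: arcs_ends_conv)
  have "finite {w. w \<rightarrow>\<^sup>+ head G e}"
    by (rule finite_subset[of _ "verts G"]) (auto dest!: tranclD simp: arcs_ends_conv)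
  moreover have "{w. w \<rightarrow>\<^sup>+ tail G e} \<subseteq> {w. w \<rightarrow>\<^sup>+ head G e}"
    using trancl_into_trancl[OF _ e] by blast
  moreover have "tail G e \<in> {w. w \<rightarrow>\<^sup>+ head G e}" "tail G e \<notin> {w. w \<rightarrow>\<^sup>+ tail G e}"
    using e acyclic_arcs by (auto simp: acyclic_def)
  ultimately show ?thesis unfolding depth_def by (metis psubset_card_mono psubsetI)
qed

text \<open>The second conjunct carries the induction: it places a new first arc below all later
  ones.\<close>

lemma awalk_depth_sorted:
  assumes "awalk u p v"
  shows "sorted_wrt (\<lambda>e f. depth (tail G e) < depth (tail G f)) p \<and> (\<forall>e\<in>set p. depth u \<le> depth (tail G e))"
  using assms
proof (induction p arbitrary: u)
  case Nil
  then show ?case by simp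
next
  case (Cons e p)
  then have "awalk (head G e) p v" "e \<in> arcs G" "tail G e = u"
    by (auto simp: awalk_Cons_iff)
  with Cons.IH[of "head G e"] depth_less[of e] show ?case
    by fastforce
qed

lemma awalk_depth_less:
  assumes "awalk u p v" "i < j" "j < length p"
  shows "depth (tail G (p ! i)) < depth (tail G (p ! j))"
  using awalk_depth_sorted[OF assms(1)] assms(2,3) by (auto simp: sorted_wrt_iff_nth_less)

lemma awalk_distinct: "awalk u p v \<Longrightarrow> distinct p"
  unfolding distinct_conv_nth by (metis awalk_depth_less less_irrefl nat_neq_iff)

text \<open>Walks are peeled off one by one. By acyclicity a walk repeats no arc, so its removal
  lowers the value by exactly one, and the other walks are found among the remaining arcs.\<close>

lemma flow_decomposition:
  assumes "u \<noteq> v" "u \<in> verts G" "A \<subseteq> arcs G"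
    and "\<And>x. excess A x = real k * (of_bool (x = u) - of_bool (x = v))"
  shows "\<exists>q. (\<forall>j<k. awalk u (q j) v \<and> set (q j) \<subseteq> A) \<and>
    (\<forall>i<k. \<forall>j<k. i \<noteq> j \<longrightarrow> set (q i) \<inter> set (q j) = {})"
  using assms(3,4)
proof (induction k arbitrary: A)
  case 0
  then show ?case by simp
next
  case (Suc k)
  have "excess A u > 0" using Suc.prems(2)[of u] assms(1) by simp
  with awalk_in_flow[OF Suc.prems(1) assms(2), of v] obtain p where
    p: "awalk u p v" "set p \<subseteq> A" using Suc.prems(2) by fastforce
  have "excess (A - set p) x = real k * (of_bool (x = u) - of_bool (x = v))" for x
    using excess_remove_awalk[OF p(1) awalk_distinct[OF p(1)] p(2), of x] Suc.prems(2)[of x]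
    by (simp add: algebra_simps)
  moreover have "A - set p \<subseteq> arcs G" using Suc.prems(1) by blast
  ultimately obtain q where q0: "\<forall>j<k. awalk u (q j) v \<and> set (q j) \<subseteq> A - set p"
      "\<forall>i<k. \<forall>j<k. i \<noteq> j \<longrightarrow> set (q i) \<inter> set (q j) = {}"
    using Suc.IH[of "A - set p"] by metis
  then have q: "\<And>j. j < k \<Longrightarrow> awalk u (q j) v \<and> set (q j) \<subseteq> A - set p"
      "\<And>i j. i < k \<Longrightarrow> j < k \<Longrightarrow> i \<noteq> j \<Longrightarrow> set (q i) \<inter> set (q j) = {}"
    by blast+
  have "awalk u ((q(k := p)) j) v \<and> set ((q(k := p)) j) \<subseteq> A" if "j < Suc k" for j
    using p q(1)[of j] that by (cases "j = k") auto
  moreover have "set ((q(k := p)) i) \<inter> set ((q(k := p)) j) = {}"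
    if "i < Suc k" "j < Suc k" "i \<noteq> j" for i j
    using q(1)[of i] q(1)[of j] q(2)[of i j] that by (cases "i = k"; cases "j = k") auto
  ultimately show ?case by blast
qed

text \<open>Menger's theorem for arcs: the flow bound forces large cuts, these give an integral flow
  of value \<open>k\<close>, and that splits into \<open>k\<close> walks.\<close>

theorem disjoint_awalks:
  assumes "u \<noteq> v" "u \<in> verts G" "real k \<le> max_flow G u v"
  shows "\<exists>q. (\<forall>j<k. awalk u (q j) v) \<and>
    (\<forall>i<k. \<forall>j<k. i \<noteq> j \<longrightarrow> set (q i) \<inter> set (q j) = {})"
proof -
  have "k \<le> card {e\<in>arcs G. tail G e \<in> U \<and> head G e \<notin> U}"
    if "U \<subseteq> verts G" "u \<in> U" "v \<notin> U" for U
    using max_flow_le_cut[OF that] assms(3) by simp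
  from integral_flow[OF assms(2) this] obtain A where "A \<subseteq> arcs G"
    "\<And>x. excess A x = real k * (of_bool (x = u) - of_bool (x = v))" by blast
  from flow_decomposition[OF assms(1,2) this] obtain q where
    q: "\<forall>j<k. awalk u (q j) v \<and> set (q j) \<subseteq> A"
      "\<forall>i<k. \<forall>j<k. i \<noteq> j \<longrightarrow> set (q i) \<inter> set (q j) = {}"
    by (elim exE conjE)
  have "\<forall>j<k. awalk u (q j) v" using q(1) by blast
  with q(2) show ?thesis by (intro exI[of _ q] conjI)
qed

end

section \<open>Coding for one time slot\<close>

text \<open>What a node can form by adding and subtracting its inputs. Symbols are integer-valued
  functions of the messages \<open>x\<close>, so the code is verified by exact integer identities
  and reduced modulo 2 only afterwards.\<close>

inductive computable :: "('m \<Rightarrow> 'b \<Rightarrow> int) \<Rightarrow> 'b set \<Rightarrow> ('m \<Rightarrow> int) set \<Rightarrow> ('m \<Rightarrow> int) \<Rightarrow> bool"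
  for y I M where
  arc: "e \<in> I \<Longrightarrow> computable y I M (\<lambda>x. y x e)"
| message: "g \<in> M \<Longrightarrow> computable y I M g"
| zero: "computable y I M (\<lambda>_. 0)"
| add: "computable y I M g \<Longrightarrow> computable y I M h \<Longrightarrow> computable y I M (\<lambda>x. g x + h x)"
| diff: "computable y I M g \<Longrightarrow> computable y I M h \<Longrightarrow> computable y I M (\<lambda>x. g x - h x)"

text \<open>Only arcs before index \<open>i\<close> count, so \<open>last_met lb p i\<close> is the
  label that the walk brings to its arc \<open>p ! i\<close>, and index \<open>Suc i\<close> gives
  the label after that arc.\<close>

primrec last_met :: "('b \<Rightarrow> nat option) \<Rightarrow> 'b list \<Rightarrow> nat \<Rightarrow> nat option" where
  "last_met lb p 0 = None"
| "last_met lb p (Suc i) = (case lb (p ! i) of None \<Rightarrow> last_met lb p i | Some j \<Rightarrow> Some j)"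

lemma last_met_SomeD: "last_met lb p i = Some j \<Longrightarrow> \<exists>k<i. lb (p ! k) = Some j"
  by (induction i) (auto split: option.splits simp: less_Suc_eq)

lemma last_met_NoneD: "last_met lb p i = None \<Longrightarrow> k < i \<Longrightarrow> lb (p ! k) = None"
  by (induction i) (auto split: option.splits simp: less_Suc_eq)

definition position :: "'b list \<Rightarrow> 'b \<Rightarrow> nat" where
  "position xs e = (THE m. m < length xs \<and> xs ! m = e)"

lemma position_nth: "distinct xs \<Longrightarrow> m < length xs \<Longrightarrow> position xs (xs ! m) = m"
  unfolding position_def by (rule the_equality) (auto simp: nth_eq_iff_index_eq)

context wf_digraph
begin

text \<open>Provides the input from which arc \<open>i\<close> of a walk is encoded: source messages
  at index 0, the preceding arc later.\<close>

lemma awalk_tail_nth: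
  assumes "awalk u p v" "i < length p"
  shows "(i = 0 \<and> tail G (p ! i) = u) \<or> (\<exists>k. i = Suc k \<and> p ! k \<in> in_arcs G (tail G (p ! i)))"
  using assms
proof (induction p arbitrary: u i)
  case Nil
  then show ?case by simp
next
  case (Cons e p)
  then have e: "awalk (head G e) p v" "e \<in> arcs G" "tail G e = u" by (auto simp: awalk_Cons_iff)
  show ?case
  proof (cases i)
    case 0
    then show ?thesis using e by simp
  next
    case (Suc k)
    then show ?thesis using Cons.IH[OF e(1), of k] Cons.prems(2) e(2) by (cases k) auto
  qed
qed

lemma awalk_last_in_arcs:
  assumes "awalk u p v" "p \<noteq> []"
  shows "p ! (length p - 1) \<in> in_arcs G v"
  using assms
proof (induction p arbitrary: u)
  case Nil
  then show ?case by simp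
next
  case (Cons e p)
  then have e: "awalk (head G e) p v" "e \<in> arcs G" by (auto simp: awalk_Cons_iff)
  show ?case
  proof (cases "p = []")
    case True
    then show ?thesis using e by (simp add: awalk_Nil_iff)
  next
    case False
    then show ?thesis using Cons.IH[OF e(1)] by (cases p) auto
  qed
qed

end

text \<open>\<open>X\<close>, \<open>A\<close>, \<open>B\<close> are the symbols sent in the slot.
  Taking a union of message sets also covers coinciding sources. The decoding rule is an integer
  combination of two received symbols, a form that survives reduction modulo 2.\<close>

lemma (in acyclic_digraph) slot_code:
  fixes X A B :: "'m \<Rightarrow> int"
    and q :: "nat \<Rightarrow> 'b list"
  assumes p: "awalk s\<^sub>1 p t\<^sub>1" "p \<noteq> []"
    and q: "\<And>j. j < 3 \<Longrightarrow> awalk s\<^sub>2 (q j) t\<^sub>2" "\<And>j. j < 3 \<Longrightarrow> q j \<noteq> []"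
    and disj: "\<And>i j. i < 3 \<Longrightarrow> j < 3 \<Longrightarrow> i \<noteq> j \<Longrightarrow> set (q i) \<inter> set (q j) = {}"
  obtains y where
    "\<And>e. e \<in> arcs G \<Longrightarrow> computable y (in_arcs G (tail G e))
       ({g. g = X \<and> tail G e = s\<^sub>1} \<union> {g. g \<in> {A, B} \<and> tail G e = s\<^sub>2}) (\<lambda>x. y x e)"
    "\<exists>l\<in>in_arcs G t\<^sub>1. \<forall>x. y x l = X x"
    "\<And>g. g \<in> {A, B} \<Longrightarrow> \<exists>l\<in>in_arcs G t\<^sub>2. \<exists>l'\<in>in_arcs G t\<^sub>2. \<exists>c. \<forall>x. g x = y x l - c * y x l'"
proof -
  \<comment> \<open>The index of the walk \<open>q j\<close> through \<open>e\<close>; it is unique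
    because these walks are arc-disjoint.\<close>
  define lb where "lb e = (if \<exists>j<3. e \<in> set (q j) then Some (SOME j. j < 3 \<and> e \<in> set (q j)) else None)" for e
  have lb_Some: "lb e = Some j \<longleftrightarrow> j < 3 \<and> e \<in> set (q j)" for e j
  proof
    assume "lb e = Some j"
    then show "j < 3 \<and> e \<in> set (q j)"
      unfolding lb_def by (metis (mono_tags, lifting) option.distinct(1) option.inject someI_ex)
  next
    assume j: "j < 3 \<and> e \<in> set (q j)"
    then have "(SOME j. j < 3 \<and> e \<in> set (q j)) = j"
      using disj by (intro some_equality) blast+
    with j show "lb e = Some j" unfolding lb_def by auto
  qed
  let ?lm = "last_met lb p"
  \<comment> \<open>The walk met last by \<open>p\<close>. If none is met, any index would do, and 0
    is taken.\<close>
  define j0 where "j0 = (case ?lm (length p) of None \<Rightarrow> 0 | Some j \<Rightarrow> j)"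
  have j0: "j0 < 3"
    using last_met_SomeD[of lb p "length p"] lb_Some by (auto simp: j0_def split: option.split)
  \<comment> \<open>\<open>j0\<close> gets the label 0, the smaller of the other two indices gets
    \<open>A\<close>, and the larger gets \<open>B\<close>.\<close>
  define u :: "nat \<Rightarrow> 'm \<Rightarrow> int" where
    "u j = (if j = j0 then (\<lambda>_. 0) else if j = (if j0 = 0 then 1 else 0) then A else B)" for j
  define U where "U z x = (case z of None \<Rightarrow> 0 | Some j \<Rightarrow> u j x)" for z x
  define met where "met j \<longleftrightarrow> (\<exists>i<length p. p ! i \<in> set (q j))" for j
  \<comment> \<open>The first meeting is taken in the order of \<open>p\<close>. The default 0 makes
    \<open>last_met\<close> return \<open>None\<close> for a walk never met, so that
    \<open>raw j\<close> is then just \<open>u j\<close>.\<close>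
  define fst_met where "fst_met j = (if met j then LEAST i. i < length p \<and> p ! i \<in> set (q j) else 0)" for j
  define raw where "raw j x = u j x - U (?lm (fst_met j)) x" for j x
  define touched where "touched j m \<longleftrightarrow> (\<exists>k<m. q j ! k \<in> set p)" for j m
  \<comment> \<open>The symbol on \<open>q j\<close> after \<open>m\<close> arcs: arc
    \<open>m\<close> carries \<open>val j (Suc m)\<close>, and \<open>val j 0\<close> is formed at
    the source.\<close>
  define val where "val j m x = (if touched j m then X x + u j x else raw j x)" for j m x
  define y where "y x e = (case lb e of Some j \<Rightarrow> val j (Suc (position (q j) e)) x
    | None \<Rightarrow> if e \<in> set p then X x + U (?lm (position p e)) x else 0)" for x e

  note walk_q = q(1)
  note dist_p = awalk_distinct[OF p(1)]
  note dist_q = awalk_distinct[OF q(1)]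
  have y_q: "y x (q j ! m) = val j (Suc m) x" if "j < 3" "m < length (q j)" for x j m
  proof -
    have "lb (q j ! m) = Some j" using that by (simp add: lb_Some)
    then show ?thesis using that by (simp add: y_def position_nth[OF dist_q])
  qed
  \<comment> \<open>On an arc shared with \<open>q j\<close> the two prescriptions agree:
    \<open>q j\<close> has been touched, and \<open>j\<close> is now the label met last.\<close>
  have y_p: "y x (p ! i) = X x + U (?lm (Suc i)) x" if i: "i < length p" for x i
  proof (cases "lb (p ! i)")
    case None
    then show ?thesis using i by (simp add: y_def position_nth[OF dist_p])
  next
    case (Some j)
    then have "j < 3" "p ! i \<in> set (q j)" by (auto simp: lb_Some)
    then obtain m where m: "j < 3" "m < length (q j)" "p ! i = q j ! m"
      by (metis in_set_conv_nth)
    moreover have "touched j (Suc m)" using m i unfolding touched_def by (metis lessI nth_mem)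
    ultimately show ?thesis using y_q[of j m x] Some by (simp add: val_def U_def)
  qed

  have comp: "computable y (in_arcs G (tail G e))
       ({g. g = X \<and> tail G e = s\<^sub>1} \<union> {g. g \<in> {A, B} \<and> tail G e = s\<^sub>2}) (\<lambda>x. y x e)"
    (is "?C e (\<lambda>x. y x e)") if "e \<in> arcs G" for e
  proof -
    have C_p: "?C (p ! i) (\<lambda>x. X x + U (?lm i) x)" if i: "i < length p" for i
      using awalk_tail_nth[OF p(1) i]
    proof (elim disjE exE conjE)
      assume "i = 0" "tail G (p ! i) = s\<^sub>1"
      then show ?thesis by (auto simp: U_def intro: computable.message)
    next
      fix k assume k: "i = Suc k" "p ! k \<in> in_arcs G (tail G (p ! i))"
      then show ?thesis
        using computable.arc[OF k(2), of y] i by (simp add: y_p del: last_met.simps)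
    qed
    have C_u: "?C e (u j)" if "tail G e = s\<^sub>2" for e j
      using that unfolding u_def by (auto intro: computable.message computable.zero)
    have C_U: "?C e (U z)" if "tail G e = s\<^sub>2" for e z
      using C_u[OF that] computable.zero unfolding U_def by (cases z) (auto simp: fun_eq_iff)
    \<comment> \<open>At the source of \<open>q j\<close> both \<open>u j\<close> and the label to
      be subtracted are known, so \<open>raw j\<close> can be formed there.\<close>
    have C_q: "?C (q j ! m) (\<lambda>x. val j m x)" if j: "j < 3" and m: "m < length (q j)" for j m
      using awalk_tail_nth[OF q(1)[OF j] m]
    proof (elim disjE exE conjE)
      assume "m = 0" and s: "tail G (q j ! m) = s\<^sub>2"
      then have "val j m = (\<lambda>x. u j x - U (?lm (fst_met j)) x)"
        by (auto simp: val_def touched_def raw_def fun_eq_iff)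
      then show ?thesis using computable.diff[OF C_u[OF s] C_U[OF s]] by simp
    next
      fix k assume k: "m = Suc k" "q j ! k \<in> in_arcs G (tail G (q j ! m))"
      then show ?thesis
        using computable.arc[OF k(2), of y] j m by (simp add: y_q)
    qed
    consider (q) j m where "j < 3" "m < length (q j)" "e = q j ! m"
      | (p) i where "i < length p" "e = p ! i" "lb e = None"
      | (no) "e \<notin> set p" "lb e = None"
      by (metis in_set_conv_nth lb_Some not_None_eq)
    then show ?thesis
    proof cases
      case q
      show ?thesis
      \<comment> \<open>The symbol on \<open>q j\<close> changes only at its first arc shared with
        \<open>p\<close>; every other arc forwards.\<close>
      proof (cases "touched j (Suc m) \<and> \<not> touched j m")
        case False
        then have "val j (Suc m) = val j m"
          unfolding val_def touched_def by (auto simp: fun_eq_iff less_Suc_eq)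
        then show ?thesis using C_q[OF q(1,2)] q by (simp add: y_q)
      next
        case True
        then have "e \<in> set p" unfolding q(3) touched_def by (auto simp: less_Suc_eq)
        then obtain i where i: "i < length p" "e = p ! i" by (metis in_set_conv_nth)
        have hit: "i < length p \<and> p ! i \<in> set (q j)" using i q by (metis nth_mem)
        then have "met j" unfolding met_def by blast
        then have f: "fst_met j = (LEAST i. i < length p \<and> p ! i \<in> set (q j))"
          by (simp add: fst_met_def)
        have f1: "fst_met j < length p \<and> p ! fst_met j \<in> set (q j)"
          unfolding f by (rule LeastI) (fact hit)
        have f2: "fst_met j \<le> i" unfolding f by (rule Least_le) (fact hit)
        \<comment> \<open>The first common arc along \<open>q j\<close> is also the first along
          \<open>p\<close>: an earlier one on \<open>p\<close> would have smaller depth, hence also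
          come earlier on \<open>q j\<close>. So the label subtracted in \<open>raw j\<close> is the
          one \<open>p\<close> brings here, and it cancels in the sum.\<close>
        have "fst_met j = i"
        proof (rule ccontr)
          assume "fst_met j \<noteq> i"
          with f2 have less: "depth (tail G (p ! fst_met j)) < depth (tail G (p ! i))"
            using awalk_depth_less[OF p(1), of "fst_met j" i] i by simp
          obtain k where k: "k < length (q j)" "q j ! k = p ! fst_met j"
            using f1 by (metis in_set_conv_nth)
          have "k < m"
          proof (rule ccontr)
            assume "\<not> k < m"
            then have "depth (tail G (q j ! m)) \<le> depth (tail G (q j ! k))"
              using awalk_depth_less[OF walk_q[OF q(1)], of m k] k(1) by (cases "k = m") auto
            then show False using less k q i by simp
          qed
          then show False using True k f1 unfolding touched_def by (metis nth_mem)
        qed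
        then have "y x e = (X x + U (?lm i) x) + val j m x" for x
          using True q by (simp add: y_q val_def raw_def)
        moreover have "?C e (\<lambda>x. (X x + U (?lm i) x) + val j m x)"
          by (rule computable.add) (use C_p[OF i(1)] C_q[OF q(1,2)] i q in auto)
        ultimately show ?thesis by simp
      qed
    next
      case p
      then show ?thesis using C_p[OF p(1)] by (simp add: y_p)
    next
      case no
      then show ?thesis by (simp add: y_def computable.zero)
    qed
  qed

  have u0: "u j0 x = 0" for x by (simp add: u_def)
  have last_p: "y x (p ! (length p - 1)) = X x" for x
  proof -
    have "y x (p ! (length p - 1)) = X x + U (?lm (length p)) x"
      using y_p[of "length p - 1" x] p(2) by (simp del: last_met.simps)
    moreover have "U (?lm (length p)) x = 0"
      using u0[of x] by (auto simp: U_def j0_def split: option.splits)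
    ultimately show ?thesis by simp
  qed
  have last_q: "y x (q j ! (length (q j) - 1)) = u j x + of_bool (met j) * X x" if j: "j < 3" for x j
  proof -
    have "y x (q j ! (length (q j) - 1)) = val j (length (q j)) x"
      using y_q[of j "length (q j) - 1" x] q(2)[OF j] j by simp
    moreover have "touched j (length (q j)) \<longleftrightarrow> met j"
      unfolding touched_def met_def by (metis in_set_conv_nth)
    moreover have "raw j x = u j x" if "\<not> met j"
      using that by (simp add: raw_def fst_met_def U_def)
    ultimately show ?thesis by (simp add: val_def)
  qed
  \<comment> \<open>If \<open>p\<close> meets any of the walks, then there is one that it meets
    last, and this is \<open>j0\<close>.\<close>
  have met_j0: "met j0" if "met j" "j < 3" for j
  proof (cases "?lm (length p)")
    case None
    then show ?thesis using last_met_NoneD[OF None] that unfolding met_def by (metis lb_Some option.distinct(1))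
  next
    case (Some k)
    then show ?thesis using last_met_SomeD[OF Some] unfolding met_def j0_def by (auto simp: lb_Some)
  qed
  \<comment> \<open>A met walk \<open>q j\<close> ends with \<open>X + u j\<close>; then
    \<open>j0\<close> is met too and ends with \<open>X\<close> alone, which is subtracted. An unmet
    walk ends with \<open>u j\<close> itself.\<close>
  have dec: "u j x = y x (q j ! (length (q j) - 1)) - of_bool (met j) * y x (q j0 ! (length (q j0) - 1))"
    if "j < 3" for x j
    using met_j0[OF _ that] last_q[OF that] last_q[OF j0] u0 by (cases "met j") auto
  have end_q: "q j ! (length (q j) - 1) \<in> in_arcs G t\<^sub>2" if "j < 3" for j
    by (rule awalk_last_in_arcs[OF q(1,2)]) (use that in auto)
  have A: "\<exists>j<3. A = u j"
    by (rule exI[of _ "if j0 = 0 then 1 else 0"]) (simp add: u_def)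
  have B: "\<exists>j<3. B = u j"
    by (rule exI[of _ "if j0 = 2 then 1 else 2"]) (simp add: u_def)
  show thesis
  proof (rule that)
    show "\<exists>l\<in>in_arcs G t\<^sub>1. \<forall>x. y x l = X x"
      using awalk_last_in_arcs[OF p] last_p by blast
  next
    fix g assume "g \<in> {A, B}"
    then obtain j where "j < 3" "g = u j"
      using A B by blast
    then show "\<exists>l\<in>in_arcs G t\<^sub>2. \<exists>l'\<in>in_arcs G t\<^sub>2. \<exists>c. \<forall>x. g x = y x l - c * y x l'"
      using end_q[of j] end_q[OF j0] dec[of j] by blast
  qed (fact comp)
qed

section \<open>Linear functionals over the field with two elements\<close>

text \<open>Reduces the encoder of an arc to one linear functional for each time slot.\<close>

lemma linear_map_into_power_module:
  assumes "\<And>j. j \<in> J \<Longrightarrow> linear_map F M N (\<psi> j)"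
  shows "linear_map F M (power_module J N) (\<lambda>z. \<lambda>j\<in>J. \<psi> j z)"
proof -
  have "\<psi> j z \<in> carrier N" if "j \<in> J" "z \<in> carrier M" for j z
    using assms[OF that(1)] that(2) unfolding linear_map_def by blast
  then show ?thesis
    using assms unfolding linear_map_def power_module_def by (auto intro!: restrict_ext)
qed

abbreviation (input) "F2 \<equiv> residue_ring 2"

lemma linear_functional_F2_iff:
  "linear_map F2 M (self_module F2) \<psi> \<longleftrightarrow> \<psi> \<in> carrier M \<rightarrow> {0..1} \<and>
    (\<forall>x\<in>carrier M. \<forall>y\<in>carrier M. \<psi> (x \<oplus>\<^bsub>M\<^esub> y) = (\<psi> x + \<psi> y) mod 2) \<and>
    (\<forall>a\<in>{0..1}. \<forall>x\<in>carrier M. \<psi> (a \<odot>\<^bsub>M\<^esub> x) = (a * \<psi> x) mod 2)"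
  by (simp add: linear_map_def self_module_def residue_ring_def)

lemma linear_functional_F2_zero: "linear_map F2 M (self_module F2) (\<lambda>_. 0)"
  by (simp add: linear_functional_F2_iff)

lemma linear_functional_F2_add:
  assumes "linear_map F2 M (self_module F2) \<psi>" "linear_map F2 M (self_module F2) \<chi>"
  shows "linear_map F2 M (self_module F2) (\<lambda>z. (\<psi> z + \<chi> z) mod 2)"
  unfolding linear_functional_F2_iff
proof (intro conjI ballI)
  fix x y assume "x \<in> carrier M" "y \<in> carrier M"
  then have "\<psi> (x \<oplus>\<^bsub>M\<^esub> y) = (\<psi> x + \<psi> y) mod 2" "\<chi> (x \<oplus>\<^bsub>M\<^esub> y) = (\<chi> x + \<chi> y) mod 2"
    using assms unfolding linear_functional_F2_iff by blast+
  then show "(\<psi> (x \<oplus>\<^bsub>M\<^esub> y) + \<chi> (x \<oplus>\<^bsub>M\<^esub> y)) mod 2 = ((\<psi> x + \<chi> x) mod 2 + (\<psi> y + \<chi> y) mod 2) mod 2"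
    by (simp only: mod_add_eq) (simp add: algebra_simps)
next
  fix a :: int and x assume a: "a \<in> {0..1}" and "x \<in> carrier M"
  then have "\<psi> (a \<odot>\<^bsub>M\<^esub> x) = (a * \<psi> x) mod 2" "\<chi> (a \<odot>\<^bsub>M\<^esub> x) = (a * \<chi> x) mod 2"
    using assms unfolding linear_functional_F2_iff by blast+
  moreover have "a = 0 \<or> a = 1" using a by auto
  ultimately show "(\<psi> (a \<odot>\<^bsub>M\<^esub> x) + \<chi> (a \<odot>\<^bsub>M\<^esub> x)) mod 2 = (a * ((\<psi> x + \<chi> x) mod 2)) mod 2"
    by (auto simp: mod_simps)
qed auto

lemma linear_functional_F2_diff:
  assumes "linear_map F2 M (self_module F2) \<psi>" "linear_map F2 M (self_module F2) \<chi>"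
  shows "linear_map F2 M (self_module F2) (\<lambda>z. (\<psi> z - \<chi> z) mod 2)"
  unfolding linear_functional_F2_iff
proof (intro conjI ballI)
  fix x y assume "x \<in> carrier M" "y \<in> carrier M"
  then have "\<psi> (x \<oplus>\<^bsub>M\<^esub> y) = (\<psi> x + \<psi> y) mod 2" "\<chi> (x \<oplus>\<^bsub>M\<^esub> y) = (\<chi> x + \<chi> y) mod 2"
    using assms unfolding linear_functional_F2_iff by blast+
  then show "(\<psi> (x \<oplus>\<^bsub>M\<^esub> y) - \<chi> (x \<oplus>\<^bsub>M\<^esub> y)) mod 2 = ((\<psi> x - \<chi> x) mod 2 + (\<psi> y - \<chi> y) mod 2) mod 2"
    by (simp only: mod_add_eq mod_diff_eq) (simp add: algebra_simps)
next
  fix a :: int and x assume a: "a \<in> {0..1}" and "x \<in> carrier M"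
  then have "\<psi> (a \<odot>\<^bsub>M\<^esub> x) = (a * \<psi> x) mod 2" "\<chi> (a \<odot>\<^bsub>M\<^esub> x) = (a * \<chi> x) mod 2"
    using assms unfolding linear_functional_F2_iff by blast+
  moreover have "a = 0 \<or> a = 1" using a by auto
  ultimately show "(\<psi> (a \<odot>\<^bsub>M\<^esub> x) - \<chi> (a \<odot>\<^bsub>M\<^esub> x)) mod 2 = (a * ((\<psi> x - \<chi> x) mod 2)) mod 2"
    by (auto simp: mod_simps)
qed auto

lemma linear_functional_F2_component:
  assumes "u \<in> I" "c < T"
  shows "linear_map F2 (power_module I (vec_space F2 T)) (self_module F2) (\<lambda>z. z u c)"
proof -
  have "z u c \<in> {0..1}" if "z \<in> carrier (power_module I (vec_space F2 T))" for z
    using that assms by (auto simp: power_module_def vec_space_def self_module_def residue_ring_def PiE_iff)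
  then show ?thesis
    using assms unfolding linear_functional_F2_iff
    by (simp add: power_module_def vec_space_def self_module_def residue_ring_def Pi_iff)
qed

text \<open>The passage from integers to the field: if the available symbols are, modulo 2, linear
  functionals of the node's input \<open>r x\<close>, then so is all that \<open>computable\<close>
  builds from them by sums and differences.\<close>

lemma computable_linear_functional:
  fixes y :: "'m \<Rightarrow> 'b \<Rightarrow> int"
  assumes "computable y I N g"
    and "\<And>e. e \<in> I \<Longrightarrow> \<exists>\<psi>. linear_map F2 M (self_module F2) \<psi> \<and> (\<forall>x\<in>S. \<psi> (r x) = y x e mod 2)"
    and "\<And>g. g \<in> N \<Longrightarrow> \<exists>\<psi>. linear_map F2 M (self_module F2) \<psi> \<and> (\<forall>x\<in>S. \<psi> (r x) = g x mod 2)"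
  shows "\<exists>\<psi>. linear_map F2 M (self_module F2) \<psi> \<and> (\<forall>x\<in>S. \<psi> (r x) = g x mod 2)"
  using assms(1)
proof induction
  case zero
  then show ?case using linear_functional_F2_zero by force
next
  case (add g h)
  then obtain \<psi> \<chi> where "linear_map F2 M (self_module F2) \<psi>" "\<forall>x\<in>S. \<psi> (r x) = g x mod 2"
    "linear_map F2 M (self_module F2) \<chi>" "\<forall>x\<in>S. \<chi> (r x) = h x mod 2" by blast
  then show ?case
    by (intro exI[of _ "\<lambda>z. (\<psi> z + \<chi> z) mod 2"] conjI linear_functional_F2_add) (auto simp: mod_add_eq)
next
  case (diff g h)
  then obtain \<psi> \<chi> where "linear_map F2 M (self_module F2) \<psi>" "\<forall>x\<in>S. \<psi> (r x) = g x mod 2"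
    "linear_map F2 M (self_module F2) \<chi>" "\<forall>x\<in>S. \<chi> (r x) = h x mod 2" by blast
  then show ?case
    by (intro exI[of _ "\<lambda>z. (\<psi> z - \<chi> z) mod 2"] conjI linear_functional_F2_diff) (auto simp: mod_diff_eq)
qed (use assms in auto)

section \<open>Feasibility\<close>

text \<open>A node that is both source and terminal has no arcs at all, so every flow from it has
  value 0.\<close>

lemma (in multiple_unicast) source_neq_terminal:
  assumes "i \<in> {1..n}" "max_flow G (s i) (t i) > 0"
  shows "s i \<noteq> t i"
proof
  assume eq: "s i = t i"
  have "is_flow G (s i) (t i) (\<lambda>_. 0)" by (simp add: is_flow_def)
  then have "max_flow G (s i) (t i) \<le> 0"
    unfolding max_flow_def using no_arc_into_source[OF assms(1)] no_arc_from_terminal[OF assms(1)] eq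
    by (intro cSup_least) (auto simp: flow_value_def)
  with assms(2) show False by simp
qed

text \<open>It suffices that the received symbols determine \<open>x i\<close>: the decoder picks
  any message tuple consistent with them.\<close>

lemma recoverableI:
  assumes "\<And>x x'. x \<in> messages n F T \<Longrightarrow> x' \<in> messages n F T \<Longrightarrow>
    (\<And>e. e \<in> in_arcs G (t i) \<Longrightarrow> Y x e = Y x' e) \<Longrightarrow> x i = x' i"
  shows "recoverable G n t F T Y i"
proof -
  let ?r = "\<lambda>x. restrict (Y x) (in_arcs G (t i))"
  have "(SOME x'. x' \<in> messages n F T \<and> ?r x' = ?r x) i = x i" if x: "x \<in> messages n F T" for x
  proof -
    define x' where "x' = (SOME x'. x' \<in> messages n F T \<and> ?r x' = ?r x)"
    have "x' \<in> messages n F T \<and> ?r x' = ?r x"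
      unfolding x'_def by (rule someI[of _ x]) (simp add: x)
    then have x': "x' \<in> messages n F T" "?r x' = ?r x" by auto
    have "Y x' e = Y x e" if "e \<in> in_arcs G (t i)" for e
      using fun_cong[OF x'(2), of e] that by simp
    then show ?thesis
      unfolding x'_def[symmetric] by (rule assms[OF x'(1) x])
  qed
  then have "\<forall>x\<in>messages n F T. (\<lambda>r. (SOME x'. x' \<in> messages n F T \<and> ?r x' = r) i) (?r x) = x i"
    by blast
  then show ?thesis
    unfolding recoverable_def by (intro exI[of _ "\<lambda>r. (SOME x'. x' \<in> messages n F T \<and> ?r x' = r) i"]) simp
qed

theorem mainTheorem8:
  fixes G :: "('a, 'b) pre_digraph" and s t :: "nat \<Rightarrow> 'a" and k :: "nat \<Rightarrow> real"
  assumes "multiple_unicast G 3 s t"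
    and "\<And>i. i \<in> {1..3} \<Longrightarrow> k i = max_flow G (s i) (t i)"
    and "k 1 \<ge> 1" and "k 2 \<ge> 3" and "k 3 \<ge> 3"
    and "(k 1, k 2, k 3) \<noteq> (1, 3, 3)"
  shows "feasible G 3 s t"
proof -
  interpret multiple_unicast G 3 s t by fact
  interpret acyclic_digraph G by unfold_locales (fact acyclic_arcs)
  interpret F: residues_prime 2 "residue_ring (int 2)"
    by unfold_locales simp_all
  have F2: "field F2" "finite (carrier F2)"
    using F.is_field F.finite by simp_all
  have neq: "s i \<noteq> t i" if "i \<in> {1..3}" "k i > 0" for i
    using source_neq_terminal[of i] that assms(2) by simp
  have k23: "k (\<tau> + 2) \<ge> 3" "\<tau> + 2 \<in> {1..3}" if "\<tau> < 2" for \<tau>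
  proof -
    have "\<tau> + 2 = 2 \<or> \<tau> + 2 = 3" using that by auto
    then show "k (\<tau> + 2) \<ge> 3" using assms(4,5) by metis
    show "\<tau> + 2 \<in> {1..3}" using that by simp
  qed

  \<comment> \<open>Integer codes for the two slots\<close>
  have st1: "s 1 \<noteq> t 1" "s 1 \<in> verts G" "real 1 \<le> max_flow G (s 1) (t 1)"
    using neq[of 1] assms(2)[of 1] assms(3) source_in_verts[of 1] by simp_all
  from disjoint_awalks[OF this] obtain P where "\<forall>j<1::nat. awalk (s 1) (P j) (t 1)"
    by (elim exE conjE)
  then have p: "awalk (s 1) (P 0) (t 1)" "P 0 \<noteq> []"
    using st1(1) by (auto simp: awalk_def)

  \<comment> \<open>Slot \<open>\<tau>\<close> carries component \<open>\<tau>\<close> of message 1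
    and both components of message \<open>\<tau> + 2\<close>. The two slots together deliver all
    three messages.\<close>
  define X where "X \<tau> x = x 1 \<tau>" for \<tau> :: nat and x :: "nat \<Rightarrow> nat \<Rightarrow> int"
  define A where "A \<tau> x = x (\<tau> + 2) 0" for \<tau> :: nat and x :: "nat \<Rightarrow> nat \<Rightarrow> int"
  define B where "B \<tau> x = x (\<tau> + 2) 1" for \<tau> :: nat and x :: "nat \<Rightarrow> nat \<Rightarrow> int"
  define M where "M \<tau> e = {g. g = X \<tau> \<and> tail G e = s 1} \<union> {g. g \<in> {A \<tau>, B \<tau>} \<and> tail G e = s (\<tau> + 2)}" for \<tau> e
  define code where "code \<tau> y \<longleftrightarrow>
      (\<forall>e\<in>arcs G. computable y (in_arcs G (tail G e)) (M \<tau> e) (\<lambda>x. y x e)) \<and>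
      (\<exists>l\<in>in_arcs G (t 1). \<forall>x. y x l = X \<tau> x) \<and>
      (\<forall>g\<in>{A \<tau>, B \<tau>}. \<exists>l\<in>in_arcs G (t (\<tau> + 2)). \<exists>l'\<in>in_arcs G (t (\<tau> + 2)).
        \<exists>c. \<forall>x. g x = y x l - c * y x l')" for \<tau> y

  have "\<exists>y. code \<tau> y" if \<tau>: "\<tau> < 2" for \<tau>
  proof -
    have st: "s (\<tau> + 2) \<noteq> t (\<tau> + 2)" using neq[OF k23(2)[OF \<tau>]] k23(1)[OF \<tau>] by simp
    have "real 3 \<le> max_flow G (s (\<tau> + 2)) (t (\<tau> + 2))"
      using k23[OF \<tau>] assms(2)[of "\<tau> + 2"] by simp
    from disjoint_awalks[OF st source_in_verts[OF k23(2)[OF \<tau>]] this]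
    obtain q where q: "\<forall>j<3::nat. awalk (s (\<tau> + 2)) (q j) (t (\<tau> + 2))"
      "\<forall>i<3::nat. \<forall>j<3::nat. i \<noteq> j \<longrightarrow> set (q i) \<inter> set (q j) = {}"
      by (elim exE conjE)
    have ne: "q j \<noteq> []" if "j < 3" for j :: nat
    proof
      assume "q j = []"
      then show False using q(1)[rule_format, OF that] st by (simp add: awalk_def)
    qed
    show ?thesis
    proof (rule slot_code[where X = "X \<tau>" and A = "A \<tau>" and B = "B \<tau>",
          OF p q(1)[rule_format] ne q(2)[rule_format]])
      fix y
      assume "\<And>e. e \<in> arcs G \<Longrightarrow> computable y (in_arcs G (tail G e))
          ({g. g = X \<tau> \<and> tail G e = s 1} \<union> {g. g \<in> {A \<tau>, B \<tau>} \<and> tail G e = s (\<tau> + 2)}) (\<lambda>x. y x e)"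
        "\<exists>l\<in>in_arcs G (t 1). \<forall>x. y x l = X \<tau> x"
        "\<And>g. g \<in> {A \<tau>, B \<tau>} \<Longrightarrow> \<exists>l\<in>in_arcs G (t (\<tau> + 2)). \<exists>l'\<in>in_arcs G (t (\<tau> + 2)).
          \<exists>c. \<forall>x. g x = y x l - c * y x l'"
      then have "code \<tau> y" unfolding code_def M_def by (intro conjI ballI)
      then show ?thesis by blast
    qed
  qed
  then obtain y where "\<And>\<tau>. \<tau> < 2 \<Longrightarrow> code \<tau> (y \<tau>)" by metis
  then have y: "\<And>\<tau> e. \<tau> < 2 \<Longrightarrow> e \<in> arcs G \<Longrightarrow>
        computable (y \<tau>) (in_arcs G (tail G e)) (M \<tau> e) (\<lambda>x. y \<tau> x e)"
      and y1: "\<And>\<tau>. \<tau> < 2 \<Longrightarrow> \<exists>l\<in>in_arcs G (t 1). \<forall>x. y \<tau> x l = X \<tau> x"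
      and y2: "\<And>\<tau> g. \<tau> < 2 \<Longrightarrow> g \<in> {A \<tau>, B \<tau>} \<Longrightarrow>
        \<exists>l\<in>in_arcs G (t (\<tau> + 2)). \<exists>l'\<in>in_arcs G (t (\<tau> + 2)). \<exists>c. \<forall>x. g x = y \<tau> x l - c * y \<tau> x l'"
    unfolding code_def by blast+
  \<comment> \<open>Reduction modulo 2, with slot \<open>\<tau>\<close> as component
    \<open>\<tau>\<close> of the vector on the arc.\<close>
  define Y where "Y x e = (\<lambda>\<tau>\<in>{..<2}. y \<tau> x e mod 2)" for x e

  have msg: "x i \<in> {..<2::nat} \<rightarrow>\<^sub>E {0..1}" if "x \<in> messages 3 F2 2" "i \<in> {1..3}" for x i
    using that by (auto simp: messages_def vec_space_def power_module_def self_module_def residue_ring_def)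
  have msg_mod: "x i \<tau> mod 2 = x i \<tau>" if "x \<in> messages 3 F2 2" "i \<in> {1..3}" "\<tau> < 2" for x i \<tau>
  proof -
    have "x i \<tau> \<in> {0..1}" using PiE_mem[OF msg[OF that(1,2)]] that(3) by blast
    then have "0 \<le> x i \<tau>" "x i \<tau> < 2" by simp_all
    then show ?thesis by simp
  qed
  have msg_eq: "x i = x' i" if "x \<in> messages 3 F2 2" "x' \<in> messages 3 F2 2" "i \<in> {1..3}"
    "\<And>\<tau>. \<tau> < 2 \<Longrightarrow> x i \<tau> mod 2 = x' i \<tau> mod 2" for x x' i
  proof (rule PiE_ext[OF msg[OF that(1,3)] msg[OF that(2,3)]])
    fix \<tau> :: nat assume "\<tau> \<in> {..<2}"
    then show "x i \<tau> = x' i \<tau>"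
      using that(4)[of \<tau>] msg_mod[OF that(1,3), of \<tau>] msg_mod[OF that(2,3), of \<tau>] by simp
  qed

  \<comment> \<open>Linearity and decoding over the field with two elements\<close>
  have "linear_network_code G 3 s F2 2 Y"
    unfolding linear_network_code_def
  proof
    fix e assume e: "e \<in> arcs G"
    let ?I = "inputs G 3 s (tail G e)"
    let ?N = "power_module ?I (vec_space F2 2)"
    let ?r = "\<lambda>x. restrict (case_sum (Y x) x) ?I"
    have "\<exists>\<psi>. linear_map F2 ?N (self_module F2) \<psi> \<and> (\<forall>x\<in>messages 3 F2 2. \<psi> (?r x) = y \<tau> x e mod 2)"
      if \<tau>: "\<tau> < 2" for \<tau>
    proof (rule computable_linear_functional[OF y[OF \<tau> e]])
      fix e' assume "e' \<in> in_arcs G (tail G e)"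
      then have "Inl e' \<in> ?I" by (simp add: inputs_def)
      with \<tau> show "\<exists>\<psi>. linear_map F2 ?N (self_module F2) \<psi> \<and>
          (\<forall>x\<in>messages 3 F2 2. \<psi> (?r x) = y \<tau> x e' mod 2)"
        by (intro exI[of _ "\<lambda>z. z (Inl e') \<tau>"] conjI linear_functional_F2_component) (auto simp: Y_def)
    next
      \<comment> \<open>From an arc, slot \<open>\<tau>\<close> uses component \<open>\<tau>\<close>
        only, but from an observed message it may use any component \<open>c\<close>, since both
        components of message \<open>\<tau> + 2\<close> are sent in the same slot.\<close>
      have *: "\<exists>\<psi>. linear_map F2 ?N (self_module F2) \<psi> \<and>
          (\<forall>x\<in>messages 3 F2 2. \<psi> (?r x) = x i c mod 2)"
        if "tail G e = s i" "i \<in> {1..3}" "c < 2" for i c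
      proof -
        have "Inr i \<in> ?I" using that by (simp add: inputs_def)
        with that show ?thesis
          by (intro exI[of _ "\<lambda>z. z (Inr i) c"] conjI linear_functional_F2_component) (auto simp: msg_mod)
      qed
      fix g assume "g \<in> M \<tau> e"
      then consider "g = X \<tau>" "tail G e = s 1" | "g = A \<tau>" "tail G e = s (\<tau> + 2)"
        | "g = B \<tau>" "tail G e = s (\<tau> + 2)"
        unfolding M_def by blast
      then show "\<exists>\<psi>. linear_map F2 ?N (self_module F2) \<psi> \<and> (\<forall>x\<in>messages 3 F2 2. \<psi> (?r x) = g x mod 2)"
      proof cases
        case 1
        then show ?thesis using *[of 1 \<tau>] \<tau> by (simp add: X_def)
      next
        case 2
        then show ?thesis using *[of "\<tau> + 2" 0] k23(2)[OF \<tau>] by (simp add: A_def)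
      next
        case 3
        then show ?thesis using *[of "\<tau> + 2" 1] k23(2)[OF \<tau>] by (simp add: B_def)
      qed
    qed
    then obtain \<psi> where \<psi>: "\<And>\<tau>. \<tau> < 2 \<Longrightarrow> linear_map F2 ?N (self_module F2) (\<psi> \<tau>)"
      "\<And>\<tau> x. \<tau> < 2 \<Longrightarrow> x \<in> messages 3 F2 2 \<Longrightarrow> \<psi> \<tau> (?r x) = y \<tau> x e mod 2"
      by metis
    have "linear_map F2 ?N (vec_space F2 2) (\<lambda>z. \<lambda>\<tau>\<in>{..<2}. \<psi> \<tau> z)"
      unfolding vec_space_def[of F2 2] using \<psi>(1)
      by (intro linear_map_into_power_module) (simp add: vec_space_def)
    moreover have "Y x e = (\<lambda>\<tau>\<in>{..<2}. \<psi> \<tau> (?r x))" if "x \<in> messages 3 F2 2" for x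
      unfolding Y_def[of x e] using \<psi>(2)[OF _ that] by (intro restrict_ext) simp
    ultimately show "\<exists>\<phi>. linear_map F2 ?N (vec_space F2 2) \<phi> \<and> (\<forall>x\<in>messages 3 F2 2. Y x e = \<phi> (?r x))"
      by (intro exI[of _ "\<lambda>z. \<lambda>\<tau>\<in>{..<2}. \<psi> \<tau> z"] conjI ballI)
  qed
  moreover have "recoverable G 3 t F2 2 Y i" if i: "i \<in> {1..3}" for i
  proof (rule recoverableI)
    fix x x' assume x: "x \<in> messages 3 F2 2" "x' \<in> messages 3 F2 2"
      and eq: "\<And>e. e \<in> in_arcs G (t i) \<Longrightarrow> Y x e = Y x' e"
    have yeq: "y \<tau> x e mod 2 = y \<tau> x' e mod 2" if "e \<in> in_arcs G (t i)" "\<tau> < 2" for e \<tau>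
      using fun_cong[OF eq[OF that(1)], of \<tau>] that(2) by (simp add: Y_def)
    show "x i = x' i"
    proof (rule msg_eq[OF x i])
      fix c :: nat assume c: "c < 2"
      show "x i c mod 2 = x' i c mod 2"
      proof (cases "i = 1")
        case True
        obtain l where "l \<in> in_arcs G (t 1)" "\<forall>x. y c x l = x 1 c"
          using y1[OF c] unfolding X_def by blast
        then show ?thesis using yeq[OF _ c, of l] True by metis
      next
        case False
        \<comment> \<open>The slot that serves session \<open>i\<close>.\<close>
        define \<tau> where "\<tau> = i - 2"
        have \<tau>: "\<tau> < 2" "i = \<tau> + 2" using False i by (auto simp: \<tau>_def)
        define g where "g x = x i c" for x :: "nat \<Rightarrow> nat \<Rightarrow> int"
        have "c = 0 \<or> c = 1" using c by auto
        then have g: "g \<in> {A \<tau>, B \<tau>}"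
        proof
          assume "c = 0"
          then have "g = A \<tau>" by (simp add: fun_eq_iff g_def A_def \<tau>(2))
          then show ?thesis by simp
        next
          assume "c = 1"
          then have "g = B \<tau>" by (simp add: fun_eq_iff g_def B_def \<tau>(2))
          then show ?thesis by simp
        qed
        obtain l l' d where l: "l \<in> in_arcs G (t i)" "l' \<in> in_arcs G (t i)"
          "\<And>x. g x = y \<tau> x l - d * y \<tau> x l'"
          using y2[OF \<tau>(1) g] unfolding \<tau>(2) by blast
        \<comment> \<open>The received residues fix the decoding combination modulo 2, and message
          entries are 0 or 1, so \<open>msg_eq\<close> needs no more.\<close>
        have "(y \<tau> x l - d * y \<tau> x l') mod 2 = (y \<tau> x' l - d * y \<tau> x' l') mod 2"
          using yeq[OF l(1) \<tau>(1)] yeq[OF l(2) \<tau>(1)] by (intro mod_diff_cong mod_mult_cong) simp_all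
        then have "g x mod 2 = g x' mod 2" by (simp only: l(3))
        then show ?thesis by (simp only: g_def)
      qed
    qed
  qed
  ultimately show ?thesis
    unfolding feasible_def using F2 by (intro exI[of _ F2] exI[of _ 2] exI[of _ Y]) simp
qed

end
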